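(* For every integer $k\ge1$, the solvmanifold $M_{k,0}=G/\Lambda_{k,0}$ is diffeomorphic to the Kodaira--Thurston manifold $S^1\times \mathrm H_3(\mathbb R)/\Gamma_k$ (the product of the circle $S^1$ with the compact quotient $\mathrm H_3(\mathbb R)/\Gamma_k$).
   Context: $\mathrm H_3(\mathbb R)$ is the Heisenberg group, i.e. $\mathbb R^3$ with product $(x,y,z)(x',y',z')=(x+x',y+y',z+z'+\frac12(xy'-x'y))$, and $\Gamma_k=\mathbb Z\times\mathbb Z\times\frac1{2k}\mathbb Z\subset\mathrm H_3(\mathbb R)$, a discrete co-compact subgroup. The oscillator group $G=\mathbb R\ltimes_\alpha \mathrm H_3(\mathbb R)$ is $\mathbb R^4$ with coordinates $(t,x,y,z)$ and product $$(t,x,y,z)(t',x',y',z')=\bigl(t+t',\;x+u,\;y+v,\;z+z'+\tfrac12(xv-uy)\bigr),$$ where $u=x'\cos t+y'\sin t$ and $v=-x'\sin t+y'\cos t$. The subgroup $\Lambda_{k,0}=2\pi\mathbb Z\times\Gamma_k\subset G$ is a discrete co-compact subgroup of $G$. *)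

theory Defs
  imports "HOL-Analysis.Analysis" "HOL-Algebra.Left_Coset"
begin

section \<open>Smooth maps between Euclidean spaces\<close>

text \<open>Only used for open \<open>S\<close>: \<open>f\<close> is of class \<open>C^k\<close> on \<open>S\<close> if it is differentiable there and all
  its directional derivatives are of class \<open>C^(k-1)\<close>. Euclidean spaces are finite-dimensional, so
  this is the usual notion.\<close>

fun Ck_on :: "nat \<Rightarrow> 'a::euclidean_space set \<Rightarrow> ('a \<Rightarrow> 'b::euclidean_space) \<Rightarrow> bool" where
  "Ck_on 0 S f \<longleftrightarrow> continuous_on S f"
| "Ck_on (Suc k) S f \<longleftrightarrow>
     (\<forall>x\<in>S. f differentiable (at x)) \<and> (\<forall>v. Ck_on k S (\<lambda>x. frechet_derivative f (at x) v))"

definition smooth_on :: "'a::euclidean_space set \<Rightarrow> ('a \<Rightarrow> 'b::euclidean_space) \<Rightarrow> bool" where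
  "smooth_on S f \<longleftrightarrow> (\<forall>k. Ck_on k S f)"


section \<open>Smooth manifolds and diffeomorphisms\<close>

text \<open>A chart \<open>(U, \<phi>)\<close> consists of its domain \<open>U\<close> and its coordinate map \<open>\<phi>\<close>; values of \<open>\<phi>\<close> outside
  \<open>U\<close> are irrelevant, and the inverse of the coordinate map is \<^term>\<open>inv_into U \<phi>\<close>. The
  atlas is not required to be maximal.\<close>

record ('p, 'e) mfd =
  mtop :: "'p topology"
  charts :: "('p set \<times> ('p \<Rightarrow> 'e)) set"

definition is_chart :: "'p topology \<Rightarrow> 'p set \<Rightarrow> ('p \<Rightarrow> 'e::euclidean_space) \<Rightarrow> bool" where
  "is_chart X U \<phi> \<longleftrightarrow>
     openin X U \<and> open (\<phi> ` U) \<and> homeomorphic_map (subtopology X U) (top_of_set (\<phi> ` U)) \<phi>"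

definition second_countable_space :: "'p topology \<Rightarrow> bool" where
  "second_countable_space X \<longleftrightarrow>
     (\<exists>\<B>. countable \<B> \<and> (\<forall>B\<in>\<B>. openin X B) \<and>
          (\<forall>U x. openin X U \<and> x \<in> U \<longrightarrow> (\<exists>B\<in>\<B>. x \<in> B \<and> B \<subseteq> U)))"

definition smooth_manifold :: "('p, 'e::euclidean_space) mfd \<Rightarrow> bool" where
  "smooth_manifold M \<longleftrightarrow>
     Hausdorff_space (mtop M) \<and> second_countable_space (mtop M) \<and>
     (\<forall>(U, \<phi>)\<in>charts M. is_chart (mtop M) U \<phi>) \<and>
     (\<Union>(U, \<phi>)\<in>charts M. U) = topspace (mtop M) \<and>
     (\<forall>(U, \<phi>)\<in>charts M. \<forall>(V, \<psi>)\<in>charts M.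
        smooth_on (\<phi> ` (U \<inter> V)) (\<psi> \<circ> inv_into U \<phi>))"

definition smooth_map ::
  "('p, 'e::euclidean_space) mfd \<Rightarrow> ('q, 'f::euclidean_space) mfd \<Rightarrow> ('p \<Rightarrow> 'q) \<Rightarrow> bool" where
  "smooth_map M N f \<longleftrightarrow>
     continuous_map (mtop M) (mtop N) f \<and>
     (\<forall>(U, \<phi>)\<in>charts M. \<forall>(V, \<psi>)\<in>charts N.
        smooth_on (\<phi> ` (U \<inter> f -` V)) (\<psi> \<circ> f \<circ> inv_into U \<phi>))"

definition diffeomorphic ::
  "('p, 'e::euclidean_space) mfd \<Rightarrow> ('q, 'f::euclidean_space) mfd \<Rightarrow> bool" where
  "diffeomorphic M N \<longleftrightarrow>
     smooth_manifold M \<and> smooth_manifold N \<and>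
     (\<exists>f g. smooth_map M N f \<and> smooth_map N M g \<and>
        (\<forall>x\<in>topspace (mtop M). g (f x) = x) \<and> (\<forall>y\<in>topspace (mtop N). f (g y) = y))"

definition prod_mfd ::
  "('p, 'e::euclidean_space) mfd \<Rightarrow> ('q, 'f::euclidean_space) mfd \<Rightarrow> ('p \<times> 'q, 'e \<times> 'f) mfd" where
  "prod_mfd M N =
     \<lparr>mtop = prod_topology (mtop M) (mtop N),
      charts = {(U \<times> V, map_prod \<phi> \<psi>) | U \<phi> V \<psi>. (U, \<phi>) \<in> charts M \<and> (V, \<psi>) \<in> charts N}\<rparr>"

text \<open>The unit circle in the complex plane, with the angle functions as charts.\<close>

definition circle_mfd :: "(complex, real) mfd" where
  "circle_mfd =
     \<lparr>mtop = top_of_set (sphere 0 1),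
      charts = {(cis ` {a<..<a + 2 * pi}, inv_into {a<..<a + 2 * pi} cis) | a. True}\<rparr>"


section \<open>Quotients of Lie groups by discrete subgroups\<close>

definition quotient_topology :: "'a topology \<Rightarrow> ('a \<Rightarrow> 'b) \<Rightarrow> 'b topology" where
  "quotient_topology X p =
     topology (\<lambda>U. U \<subseteq> p ` topspace X \<and> openin X {x \<in> topspace X. p x \<in> U})"

lemma openin_quotient_topology:
  "openin (quotient_topology X p) U \<longleftrightarrow>
     U \<subseteq> p ` topspace X \<and> openin X {x \<in> topspace X. p x \<in> U}"
proof -
  have "istopology (\<lambda>U. U \<subseteq> p ` topspace X \<and> openin X {x \<in> topspace X. p x \<in> U})"
    unfolding istopology_def
  proof (intro conjI allI impI)
    fix S T
    assume ST: "S \<subseteq> p ` topspace X \<and> openin X {x \<in> topspace X. p x \<in> S}"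
      "T \<subseteq> p ` topspace X \<and> openin X {x \<in> topspace X. p x \<in> T}"
    then show "S \<inter> T \<subseteq> p ` topspace X" by blast
    have "{x \<in> topspace X. p x \<in> S \<inter> T} =
        {x \<in> topspace X. p x \<in> S} \<inter> {x \<in> topspace X. p x \<in> T}" by blast
    with ST show "openin X {x \<in> topspace X. p x \<in> S \<inter> T}" by auto
  next
    fix \<K>
    assume K: "\<forall>K\<in>\<K>. K \<subseteq> p ` topspace X \<and> openin X {x \<in> topspace X. p x \<in> K}"
    then show "\<Union>\<K> \<subseteq> p ` topspace X" by blast
    have "{x \<in> topspace X. p x \<in> \<Union>\<K>} = (\<Union>K\<in>\<K>. {x \<in> topspace X. p x \<in> K})" by blast
    with K show "openin X {x \<in> topspace X. p x \<in> \<Union>\<K>}" by auto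
  qed
  then show ?thesis by (simp add: quotient_topology_def)
qed

lemma topspace_quotient_topology: "topspace (quotient_topology X p) = p ` topspace X"
proof (rule antisym)
  show "topspace (quotient_topology X p) \<subseteq> p ` topspace X"
    by (meson openin_quotient_topology openin_topspace)
  have "{x \<in> topspace X. p x \<in> p ` topspace X} = topspace X" by blast
  then show "p ` topspace X \<subseteq> topspace (quotient_topology X p)"
    by (intro openin_subset) (simp add: openin_quotient_topology)
qed

lemma quotient_map_quotient_topology: "quotient_map X (quotient_topology X p) p"
  by (simp add: quotient_map_def openin_quotient_topology topspace_quotient_topology)

text \<open>\<open>G\<close> is a Lie group whose underlying manifold is an open subset of a Euclidean space, \<open>H\<close> a
  discrete subgroup. The space \<open>G/H\<close> of left cosets \<open>gH\<close> carries the quotient topology and the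
  unique smooth structure for which the projection is a local diffeomorphism: its charts are the
  inverses of the projection restricted to open sets on which it is injective.\<close>

definition coset_mfd :: "('e::euclidean_space, 'm) monoid_scheme \<Rightarrow> 'e set \<Rightarrow> ('e set, 'e) mfd" where
  "coset_mfd G H = (let \<pi> = (\<lambda>g. g <#\<^bsub>G\<^esub> H) in
     \<lparr>mtop = quotient_topology (top_of_set (carrier G)) \<pi>,
      charts = {(\<pi> ` W, inv_into W \<pi>) | W. open W \<and> W \<subseteq> carrier G \<and> inj_on \<pi> W}\<rparr>)"

lemma topspace_coset_mfd: "topspace (mtop (coset_mfd G H)) = lcosets\<^bsub>G\<^esub> H"
  by (auto simp: coset_mfd_def Let_def topspace_quotient_topology LCOSETS_def)


section \<open>The Heisenberg group and the oscillator group\<close>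

fun heis_mult :: "real \<times> real \<times> real \<Rightarrow> real \<times> real \<times> real \<Rightarrow> real \<times> real \<times> real" where
  "heis_mult (x, y, z) (x', y', z') = (x + x', y + y', z + z' + (x * y' - x' * y) / 2)"

definition Heis :: "(real \<times> real \<times> real) monoid" where
  "Heis = \<lparr>carrier = UNIV, mult = heis_mult, one = (0, 0, 0)\<rparr>"

fun osc_mult ::
  "real \<times> real \<times> real \<times> real \<Rightarrow> real \<times> real \<times> real \<times> real \<Rightarrow> real \<times> real \<times> real \<times> real" where
  "osc_mult (t, x, y, z) (t', x', y', z') =
     (let u = x' * cos t + y' * sin t; v = - x' * sin t + y' * cos t
      in (t + t', x + u, y + v, z + z' + (x * v - u * y) / 2))"

definition Osc :: "(real \<times> real \<times> real \<times> real) monoid" where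
  "Osc = \<lparr>carrier = UNIV, mult = osc_mult, one = (0, 0, 0, 0)\<rparr>"

definition Gamma_lattice :: "nat \<Rightarrow> (real \<times> real \<times> real) set" where
  "Gamma_lattice k = {(x, y, z). x \<in> \<int> \<and> y \<in> \<int> \<and> (\<exists>m::int. z = of_int m / (2 * real k))}"

definition Lambda_lattice :: "nat \<Rightarrow> (real \<times> real \<times> real \<times> real) set" where
  "Lambda_lattice k = {(t, h). (\<exists>n::int. t = 2 * pi * of_int n) \<and> h \<in> Gamma_lattice k}"

lemma group_Heis: "group Heis"
proof (rule groupI)
  fix a assume "a \<in> carrier Heis"
  obtain x y z where "a = (x, y, z)" by (cases a) auto
  then show "\<exists>b\<in>carrier Heis. b \<otimes>\<^bsub>Heis\<^esub> a = \<one>\<^bsub>Heis\<^esub>"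
    by (intro bexI[of _ "(-x, -y, -z)"]) (auto simp: Heis_def)
qed (auto simp: Heis_def algebra_simps add_divide_distrib diff_divide_distrib)

lemma group_Osc: "group Osc"
proof (rule groupI)
  fix a assume "a \<in> carrier Osc"
  obtain t x y z where a: "a = (t, x, y, z)" by (cases a) auto
  have "osc_mult (-t, -(x * cos t - y * sin t), -(x * sin t + y * cos t), -z) a = (0, 0, 0, 0)"
    unfolding a by (simp add: Let_def algebra_simps)
  then show "\<exists>b\<in>carrier Osc. b \<otimes>\<^bsub>Osc\<^esub> a = \<one>\<^bsub>Osc\<^esub>"
    by (auto simp: Osc_def)
next
  fix a b c :: "real \<times> real \<times> real \<times> real"
  obtain t x y z where a: "a = (t, x, y, z)" by (cases a) auto
  obtain t' x' y' z' where b: "b = (t', x', y', z')" by (cases b) auto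
  obtain t'' x'' y'' z'' where c: "c = (t'', x'', y'', z'')" by (cases c) auto
  define p q where "p = x'' * cos t' + y'' * sin t'" "q = - x'' * sin t' + y'' * cos t'"
  define u v where "u = x' * cos t + y' * sin t" "v = - x' * sin t + y' * cos t"
  define P Q where "P = p * cos t + q * sin t" "Q = - p * sin t + q * cos t"
  have "u * Q - P * v = (x' * q - p * y') * ((sin t)\<^sup>2 + (cos t)\<^sup>2)"
    unfolding u_v_def P_Q_def power2_eq_square by algebra
  then have area: "u * Q - P * v = x' * q - p * y'" by simp
  have PQ: "x'' * cos (t + t') + y'' * sin (t + t') = P" "- x'' * sin (t + t') + y'' * cos (t + t') = Q"
    unfolding P_Q_def p_q_def by (simp_all add: cos_add sin_add algebra_simps)
  have lin: "(x' + p) * cos t + (y' + q) * sin t = u + P"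
    "- (x' + p) * sin t + (y' + q) * cos t = v + Q"
    unfolding P_Q_def u_v_def by (simp_all add: algebra_simps)
  have ab: "osc_mult a b = (t + t', x + u, y + v, z + z' + (x * v - u * y) / 2)"
    and bc: "osc_mult b c = (t' + t'', x' + p, y' + q, z' + z'' + (x' * q - p * y') / 2)"
    by (simp_all only: a b c osc_mult.simps Let_def u_v_def p_q_def)
  have "osc_mult (osc_mult a b) c = (t + t' + t'', x + u + P, y + v + Q,
      z + z' + (x * v - u * y) / 2 + z'' + ((x + u) * Q - P * (y + v)) / 2)"
    by (simp only: ab c osc_mult.simps Let_def PQ)
  moreover have "osc_mult a (osc_mult b c) = (t + (t' + t''), x + (u + P), y + (v + Q),
      z + (z' + z'' + (x' * q - p * y') / 2) + (x * (v + Q) - (u + P) * y) / 2)"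
    by (simp only: bc a osc_mult.simps Let_def lin)
  ultimately have "osc_mult (osc_mult a b) c = osc_mult a (osc_mult b c)"
    using area by (simp add: field_simps)
  then show "a \<otimes>\<^bsub>Osc\<^esub> b \<otimes>\<^bsub>Osc\<^esub> c = a \<otimes>\<^bsub>Osc\<^esub> (b \<otimes>\<^bsub>Osc\<^esub> c)"
    by (simp add: Osc_def)
qed (auto simp: Osc_def)

lemma subgroup_Gamma:
  assumes "k \<ge> 1"
  shows "subgroup (Gamma_lattice k) Heis"
proof (rule group.subgroupI[OF group_Heis])
  show "Gamma_lattice k \<subseteq> carrier Heis" by (simp add: Heis_def)
  have "(0, 0, 0) \<in> Gamma_lattice k" by (auto simp: Gamma_lattice_def intro: exI[of _ 0])
  then show "Gamma_lattice k \<noteq> {}" by blast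
next
  fix a assume "a \<in> Gamma_lattice k"
  then obtain x y m where a: "a = (x, y, of_int m / (2 * real k))" "x \<in> \<int>" "y \<in> \<int>"
    by (auto simp: Gamma_lattice_def)
  have "inv\<^bsub>Heis\<^esub> a = (-x, -y, -(of_int m / (2 * real k)))"
    by (rule group.inv_equality[OF group_Heis]) (auto simp: a Heis_def)
  then show "inv\<^bsub>Heis\<^esub> a \<in> Gamma_lattice k"
    using a by (auto simp: Gamma_lattice_def intro!: exI[of _ "-m"])
next
  fix a b assume "a \<in> Gamma_lattice k" "b \<in> Gamma_lattice k"
  then obtain x y m x' y' m' :: int
    where a: "a = (of_int x, of_int y, of_int m / (2 * real k))"
      and b: "b = (of_int x', of_int y', of_int m' / (2 * real k))"
    by (fastforce simp: Gamma_lattice_def elim!: Ints_cases)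
  have "real_of_int m / (2 * real k) + of_int m' / (2 * real k) + (of_int x * of_int y' - of_int x' * of_int y) / 2
      = of_int (m + m' + int k * (x * y' - x' * y)) / (2 * real k)"
    using assms by (simp add: field_simps)
  then have "\<exists>n::int. real_of_int m / (2 * real k) + of_int m' / (2 * real k)
      + (of_int x * of_int y' - of_int x' * of_int y) / 2 = of_int n / (2 * real k)" by (rule exI)
  then show "a \<otimes>\<^bsub>Heis\<^esub> b \<in> Gamma_lattice k"
    unfolding a b Gamma_lattice_def Heis_def monoid.simps heis_mult.simps mem_Collect_eq prod.case
    by (intro conjI Ints_add Ints_of_int)
qed

lemma subgroup_Lambda:
  assumes "k \<ge> 1"
  shows "subgroup (Lambda_lattice k) Osc"
proof (rule group.subgroupI[OF group_Osc])
  interpret \<Gamma>: subgroup "Gamma_lattice k" Heis by (rule subgroup_Gamma[OF assms])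
  have trig: "cos (2 * pi * of_int n) = 1" "sin (2 * pi * of_int n) = 0" for n :: int
    by (simp_all add: cos_int_2pin sin_int_2pin)
  show "Lambda_lattice k \<subseteq> carrier Osc" by (simp add: Osc_def)
  have "(0, 0, 0, 0) \<in> Lambda_lattice k"
    using \<Gamma>.one_closed by (auto simp: Lambda_lattice_def Heis_def)
  then show "Lambda_lattice k \<noteq> {}" by blast
  have mult: "osc_mult (2 * pi * of_int n, h) (t', h') = (2 * pi * of_int n + t', heis_mult h h')"
    for n t' h h' by (cases h; cases h') (simp add: trig Let_def)
  fix a assume "a \<in> Lambda_lattice k"
  then obtain n h where a: "a = (2 * pi * of_int n, h)" "h \<in> Gamma_lattice k"
    by (auto simp: Lambda_lattice_def)
  {
    have "inv\<^bsub>Heis\<^esub> h \<otimes>\<^bsub>Heis\<^esub> h = \<one>\<^bsub>Heis\<^esub>"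
      by (rule group.l_inv[OF group_Heis]) (simp add: Heis_def)
    then have "osc_mult (2 * pi * of_int (-n), inv\<^bsub>Heis\<^esub> h) a = (0, 0, 0, 0)"
      unfolding a mult by (simp add: Heis_def)
    then have "inv\<^bsub>Osc\<^esub> a = (2 * pi * of_int (-n), inv\<^bsub>Heis\<^esub> h)"
      by (intro group.inv_equality[OF group_Osc]) (auto simp: Osc_def)
    then show "inv\<^bsub>Osc\<^esub> a \<in> Lambda_lattice k"
      using \<Gamma>.m_inv_closed[OF a(2)]
      unfolding Lambda_lattice_def mem_Collect_eq
      by (simp only: prod.case) (intro conjI exI[of _ "-n"], simp_all)
  }
  fix b assume "b \<in> Lambda_lattice k"
  then obtain n' h' where b: "b = (2 * pi * of_int n', h')" "h' \<in> Gamma_lattice k"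
    by (auto simp: Lambda_lattice_def)
  have "heis_mult h h' \<in> Gamma_lattice k"
    using \<Gamma>.m_closed[OF a(2) b(2)] by (simp add: Heis_def)
  moreover have "2 * pi * of_int n + 2 * pi * of_int n' = 2 * pi * real_of_int (n + n')"
    by (simp add: algebra_simps)
  ultimately show "a \<otimes>\<^bsub>Osc\<^esub> b \<in> Lambda_lattice k"
    unfolding a b Osc_def monoid.simps mult Lambda_lattice_def mem_Collect_eq prod.case
    by (intro conjI exI[of _ "n + n'"])
qed

definition M_mfd :: "nat \<Rightarrow> ((real \<times> real \<times> real \<times> real) set, real \<times> real \<times> real \<times> real) mfd" where
  "M_mfd k = coset_mfd Osc (Lambda_lattice k)"

definition Kodaira_Thurston ::
  "nat \<Rightarrow> (complex \<times> (real \<times> real \<times> real) set, real \<times> real \<times> real \<times> real) mfd" where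
  "Kodaira_Thurston k = prod_mfd circle_mfd (coset_mfd Heis (Gamma_lattice k))"

end

theory Submission
  imports Defs
begin

text \<open>The projections \<open>\<real>\<^sup>4 \<rightarrow> M\<close> and \<open>\<real>\<^sup>4 \<rightarrow> S\<^sup>1 \<times> H/\<Gamma>\<close> are coverings by local diffeomorphisms, so it is
  enough to find a diffeomorphism of \<open>\<real>\<^sup>4\<close> that matches their fibres. In the oscillator group, right
  translation by the lattice element \<open>(2 \<pi> n, \<gamma>)\<close> sends \<open>(t, h)\<close> to \<open>(t + 2 \<pi> n, h \<cdot> rot t \<gamma>)\<close>, where
  \<open>rot t\<close> is a one-parameter group of automorphisms of \<open>H\<close> of period \<open>2 \<pi>\<close>. The diffeomorphism
  \<open>(t, h) \<mapsto> (t, rot (- t) h)\<close> turns this into \<open>(t, h) \<mapsto> (t + 2 \<pi> n, h \<cdot> \<gamma>)\<close>.\<close>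

section \<open>Calculus of smooth maps\<close>

text \<open>A derivative at a point sees only a neighbourhood, so each order reduces to the previous
  one applied to the derivative of the local model \<open>g\<close>. \<open>S\<close> may be any set
  and the model may change from point to point; this fits coordinate domains that are not yet known
  to be open.\<close>

lemma Ck_on_local:
  assumes "\<And>x. x \<in> S \<Longrightarrow> \<exists>T g. open T \<and> x \<in> T \<and> Ck_on k T g \<and> (\<forall>y\<in>T. f y = g y)"
  shows "Ck_on k S f"
  using assms
proof (induction k arbitrary: f)
  case 0
  have "continuous (at x within S) f" if "x \<in> S" for x
  proof -
    obtain T g where T: "open T" "x \<in> T" "continuous_on T g" "\<forall>y\<in>T. f y = g y"
      using 0[OF \<open>x \<in> S\<close>] unfolding Ck_on.simps(1) by (elim exE conjE)
    then have "continuous_on T f" by simp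
    then show ?thesis
      using T(1,2) by (simp add: continuous_on_eq_continuous_at continuous_at_imp_continuous_at_within)
  qed
  then show ?case by (simp add: continuous_on_eq_continuous_within)
next
  case (Suc k)
  have "f differentiable at x" if "x \<in> S" for x
  proof -
    obtain T g where T: "open T" "x \<in> T" "Ck_on (Suc k) T g" "\<forall>y\<in>T. f y = g y"
      using Suc.prems[OF \<open>x \<in> S\<close>] by (elim exE conjE)
    have "g differentiable at x" using T by simp
    then have "(g has_derivative frechet_derivative g (at x)) (at x)"
      by (rule frechet_derivative_works[THEN iffD1])
    then have "(f has_derivative frechet_derivative g (at x)) (at x)"
      by (rule has_derivative_transform_within_open[OF _ T(1,2)]) (simp add: T(4))
    then show ?thesis by (rule differentiableI)
  qed
  moreover have "Ck_on k S (\<lambda>x. frechet_derivative f (at x) v)" for v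
  proof (rule Suc.IH)
    fix x assume "x \<in> S"
    obtain T g where T: "open T" "x \<in> T" "Ck_on (Suc k) T g" "\<forall>y\<in>T. f y = g y"
      using Suc.prems[OF \<open>x \<in> S\<close>] by (elim exE conjE)
    have "frechet_derivative f (at y) = frechet_derivative g (at y)" if "y \<in> T" for y
      by (rule frechet_derivative_transform_within_open[symmetric, OF _ T(1) that])
        (use T that in auto)
    with T show "\<exists>T g. open T \<and> x \<in> T \<and> Ck_on k T g \<and>
        (\<forall>y\<in>T. frechet_derivative f (at y) v = g y)"
      by (intro exI[of _ T] exI[of _ "\<lambda>y. frechet_derivative g (at y) v"]) simp
  qed
  ultimately show ?case by simp
qed

lemma Ck_on_subset: "Ck_on k S f \<Longrightarrow> T \<subseteq> S \<Longrightarrow> Ck_on k T f"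
  by (induction k arbitrary: f) (auto intro: continuous_on_subset)

lemma Ck_on_cong:
  assumes "open S" "Ck_on k S g" "\<And>x. x \<in> S \<Longrightarrow> f x = g x"
  shows "Ck_on k S f"
  using assms by (intro Ck_on_local exI[of _ S] exI[of _ g]) simp

text \<open>By uniqueness of derivatives an explicit formula \<open>f'\<close> may replace the
  choice operator hidden in \<open>frechet_derivative\<close>. The closure rules below use it to
  pass from order \<open>k\<close> to \<open>Suc k\<close>.\<close>

lemma Ck_on_SucI:
  assumes "open S" "\<And>x. x \<in> S \<Longrightarrow> (f has_derivative f' x) (at x)"
    "\<And>v. Ck_on k S (\<lambda>x. f' x v)"
  shows "Ck_on (Suc k) S f"
proof -
  have "Ck_on k S (\<lambda>x. frechet_derivative f (at x) v)" for v
    using assms by (intro Ck_on_cong[OF assms(1) assms(3)[of v]]) (metis frechet_derivative_at)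
  with assms(2) show ?thesis by (auto simp: differentiable_def)
qed

lemma Ck_on_SucD: "Ck_on (Suc k) S f \<Longrightarrow> Ck_on k S f"
proof (induction k arbitrary: f)
  case 0
  then show ?case
    by (simp add: continuous_at_imp_continuous_on differentiable_imp_continuous_within)
qed simp

lemma Ck_on_Suc_derivative:
  "Ck_on (Suc k) S f \<Longrightarrow> x \<in> S \<Longrightarrow> (f has_derivative frechet_derivative f (at x)) (at x)"
  by (rule frechet_derivative_works[THEN iffD1]) simp

lemma Ck_on_const: "open S \<Longrightarrow> Ck_on k S (\<lambda>x. c)"
proof (induction k arbitrary: c)
  case (Suc k)
  show ?case by (rule Ck_on_SucI[OF Suc.prems, where f' = "\<lambda>x v. 0"]) (auto intro: Suc)
qed simp

lemma Ck_on_bounded_linear_compose: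
  assumes "open S" "bounded_linear L" "Ck_on k S f"
  shows "Ck_on k S (\<lambda>x. L (f x))"
  using assms(3)
proof (induction k arbitrary: f)
  case 0
  then show ?case by (simp add: bounded_linear.continuous_on[OF assms(2)])
next
  case (Suc k)
  show ?case
  proof (rule Ck_on_SucI[OF assms(1)])
    show "((\<lambda>x. L (f x)) has_derivative (\<lambda>v. L (frechet_derivative f (at x) v))) (at x)"
      if "x \<in> S" for x
      by (rule bounded_linear.has_derivative[OF assms(2) Ck_on_Suc_derivative[OF Suc.prems that]])
    show "Ck_on k S (\<lambda>x. L (frechet_derivative f (at x) v))" for v
      using Suc by simp
  qed
qed

lemma Ck_on_id: "open S \<Longrightarrow> Ck_on k S (\<lambda>x. x)"
proof (cases k)
  case (Suc j)
  assume "open S"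
  then show ?thesis unfolding Suc by (intro Ck_on_SucI[where f' = "\<lambda>x v. v"]) (auto intro: Ck_on_const)
qed simp

lemma Ck_on_add:
  assumes "open S" "Ck_on k S f" "Ck_on k S g"
  shows "Ck_on k S (\<lambda>x. f x + g x)"
  using assms(2,3)
proof (induction k arbitrary: f g)
  case 0
  then show ?case by (simp add: continuous_on_add)
next
  case (Suc k)
  show ?case
  proof (rule Ck_on_SucI[OF assms(1)])
    show "((\<lambda>x. f x + g x) has_derivative
        (\<lambda>v. frechet_derivative f (at x) v + frechet_derivative g (at x) v)) (at x)"
      if "x \<in> S" for x
      by (intro has_derivative_add Suc.prems[THEN Ck_on_Suc_derivative] that)
    show "Ck_on k S (\<lambda>x. frechet_derivative f (at x) v + frechet_derivative g (at x) v)" for v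
      using Suc by simp
  qed
qed

lemma Ck_on_sum:
  assumes "open S" "finite I" "\<And>i. i \<in> I \<Longrightarrow> Ck_on k S (f i)"
  shows "Ck_on k S (\<lambda>x. \<Sum>i\<in>I. f i x)"
  using assms(2,3)
  by (induction I) (auto intro: Ck_on_const Ck_on_add assms(1))

lemma Ck_on_Pair:
  assumes "open S" "Ck_on k S f" "Ck_on k S g"
  shows "Ck_on k S (\<lambda>x. (f x, g x))"
  using assms(2,3)
proof (induction k arbitrary: f g)
  case 0
  then show ?case by (simp add: continuous_on_Pair)
next
  case (Suc k)
  show ?case
  proof (rule Ck_on_SucI[OF assms(1)])
    show "((\<lambda>x. (f x, g x)) has_derivative
        (\<lambda>v. (frechet_derivative f (at x) v, frechet_derivative g (at x) v))) (at x)"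
      if "x \<in> S" for x
      by (intro has_derivative_Pair Suc.prems[THEN Ck_on_Suc_derivative] that)
    show "Ck_on k S (\<lambda>x. (frechet_derivative f (at x) v, frechet_derivative g (at x) v))" for v
      using Suc by simp
  qed
qed

text \<open>By the Leibniz rule the derivative is a sum of products of the same kind. The
  undifferentiated factors are brought down to order \<open>k\<close> by \<open>Ck_on_SucD\<close>,
  so the induction hypothesis applies.\<close>

lemma Ck_on_scaleR:
  assumes "open S" "Ck_on k S f" "Ck_on k S g"
  shows "Ck_on k S (\<lambda>x. f x *\<^sub>R g x)"
  using assms(2,3)
proof (induction k arbitrary: f g)
  case 0
  then show ?case by (simp add: continuous_on_scaleR)
next
  case (Suc k)
  show ?case
  proof (rule Ck_on_SucI[OF assms(1)])
    show "((\<lambda>x. f x *\<^sub>R g x) has_derivative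
        (\<lambda>v. f x *\<^sub>R frechet_derivative g (at x) v + frechet_derivative f (at x) v *\<^sub>R g x)) (at x)"
      if "x \<in> S" for x
      by (intro has_derivative_scaleR Suc.prems[THEN Ck_on_Suc_derivative] that)
    show "Ck_on k S (\<lambda>x. f x *\<^sub>R frechet_derivative g (at x) v
        + frechet_derivative f (at x) v *\<^sub>R g x)" for v
      using Suc.prems[THEN Ck_on_SucD] Suc.prems by (intro Ck_on_add assms(1) Suc.IH) auto
  qed
qed

lemma Ck_on_compose:
  assumes "open S" "open T" "f ` S \<subseteq> T" "Ck_on k S f" "Ck_on k T g"
  shows "Ck_on k S (\<lambda>x. g (f x))"
  using assms(4,5)
proof (induction k arbitrary: g)
  case 0
  then show ?case using assms(3) by (auto intro: continuous_on_compose2)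
next
  case (Suc k)
  show ?case
  proof (rule Ck_on_SucI[OF assms(1)])
    fix x assume x: "x \<in> S"
    let ?f' = "frechet_derivative f (at x)" and ?g' = "frechet_derivative g (at (f x))"
    have g': "(g has_derivative ?g') (at (f x))"
      using Ck_on_Suc_derivative[OF Suc.prems(2)] x assms(3) by blast
    have "((\<lambda>x. g (f x)) has_derivative (\<lambda>v. ?g' (?f' v))) (at x)"
      using diff_chain_at[OF Ck_on_Suc_derivative[OF Suc.prems(1) x] g'] by (simp add: o_def)
    \<comment> \<open>\<open>Ck_on\<close> controls derivatives of \<open>g\<close> only in fixed
      directions, whereas \<open>?f' v\<close> varies with \<open>x\<close>. Expanding it in
      \<open>Basis\<close> leaves scalar functions times derivatives of \<open>g\<close> in fixed
      directions.\<close>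
    moreover have "?g' (?f' v) = (\<Sum>b\<in>Basis. (?f' v \<bullet> b) *\<^sub>R ?g' b)" for v
    proof -
      have lin: "linear ?g'" using g' has_derivative_linear by blast
      have "?g' (?f' v) = ?g' (\<Sum>b\<in>Basis. (?f' v \<bullet> b) *\<^sub>R b)"
        by (simp only: euclidean_representation)
      also have "\<dots> = (\<Sum>b\<in>Basis. (?f' v \<bullet> b) *\<^sub>R ?g' b)"
        by (simp add: linear_sum[OF lin] linear_scale[OF lin])
      finally show ?thesis .
    qed
    ultimately show "((\<lambda>x. g (f x)) has_derivative
        (\<lambda>v. \<Sum>b\<in>Basis. (frechet_derivative f (at x) v \<bullet> b) *\<^sub>R frechet_derivative g (at (f x)) b)) (at x)"
      by simp
  next
    show "Ck_on k S (\<lambda>x. \<Sum>b\<in>Basis.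
        (frechet_derivative f (at x) v \<bullet> b) *\<^sub>R frechet_derivative g (at (f x)) b)" for v
    proof (intro Ck_on_sum Ck_on_scaleR assms(1) finite_Basis)
      show "Ck_on k S (\<lambda>x. frechet_derivative f (at x) v \<bullet> b)" for b :: 'b
        using Suc.prems(1) by (intro Ck_on_bounded_linear_compose[OF assms(1) bounded_linear_inner_left]) auto
      show "Ck_on k S (\<lambda>x. frechet_derivative g (at (f x)) b)" for b
        using Suc.prems(2) by (intro Suc.IH Ck_on_SucD[OF Suc.prems(1)]) auto
    qed
  qed
qed

text \<open>The induction treats both functions at once, since the derivative of each involves the
  other.\<close>

lemma Ck_on_sin_cos:
  assumes "open S"
  shows "Ck_on k S (sin :: real \<Rightarrow> real) \<and> Ck_on k S (cos :: real \<Rightarrow> real)"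
proof (induction k)
  case 0
  show ?case by (auto intro: continuous_intros)
next
  case (Suc k)
  show ?case
  proof (intro conjI Ck_on_SucI[OF assms])
    show "(sin has_derivative (\<lambda>v. v *\<^sub>R cos x)) (at x)" for x :: real
      by (auto intro!: derivative_eq_intros)
    show "(cos has_derivative (\<lambda>v. (- v) *\<^sub>R sin x)) (at x)" for x :: real
      by (auto intro!: derivative_eq_intros)
    show "Ck_on k S (\<lambda>x. v *\<^sub>R cos x)" "Ck_on k S (\<lambda>x. (- v) *\<^sub>R sin x)" for v :: real
      using Suc by (intro Ck_on_scaleR Ck_on_const assms; simp)+
  qed
qed

section \<open>Closure rules for smooth functions\<close>

named_theorems smooth_intros

lemma smooth_on_const [smooth_intros]: "open S \<Longrightarrow> smooth_on S (\<lambda>x. c)"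
  and smooth_on_id [smooth_intros]: "open S \<Longrightarrow> smooth_on S (\<lambda>x. x)"
  and smooth_on_add [smooth_intros]:
    "open S \<Longrightarrow> smooth_on S f \<Longrightarrow> smooth_on S g \<Longrightarrow> smooth_on S (\<lambda>x. f x + g x)"
  and smooth_on_Pair [smooth_intros]:
    "open S \<Longrightarrow> smooth_on S f \<Longrightarrow> smooth_on S h \<Longrightarrow> smooth_on S (\<lambda>x. (f x, h x))"
  and smooth_on_compose:
    "open S \<Longrightarrow> open T \<Longrightarrow> f ` S \<subseteq> T \<Longrightarrow> smooth_on S f \<Longrightarrow> smooth_on T k \<Longrightarrow> smooth_on S (\<lambda>x. k (f x))"
  by (simp_all add: smooth_on_def Ck_on_const Ck_on_id Ck_on_add Ck_on_Pair Ck_on_compose)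

lemma smooth_on_bounded_linear_compose:
  "open S \<Longrightarrow> bounded_linear L \<Longrightarrow> smooth_on S f \<Longrightarrow> smooth_on S (\<lambda>x. L (f x))"
  by (simp add: smooth_on_def Ck_on_bounded_linear_compose)

lemma smooth_on_minus [smooth_intros]:
  "open S \<Longrightarrow> smooth_on S f \<Longrightarrow> smooth_on S (\<lambda>x. - f x)"
  using smooth_on_bounded_linear_compose[OF _ bounded_linear_minus[OF bounded_linear_ident]] .

lemma smooth_on_diff [smooth_intros]:
  "open S \<Longrightarrow> smooth_on S f \<Longrightarrow> smooth_on S g \<Longrightarrow> smooth_on S (\<lambda>x. f x - g x)"
  using smooth_on_add[of S f "\<lambda>x. - g x"] by (simp add: smooth_on_minus)

lemma smooth_on_fst [smooth_intros]: "open S \<Longrightarrow> smooth_on S f \<Longrightarrow> smooth_on S (\<lambda>x. fst (f x))"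
  and smooth_on_snd [smooth_intros]: "open S \<Longrightarrow> smooth_on S f \<Longrightarrow> smooth_on S (\<lambda>x. snd (f x))"
  by (simp_all add: smooth_on_bounded_linear_compose bounded_linear_fst bounded_linear_snd)

lemma smooth_on_mult [smooth_intros]:
  fixes f g :: "_ \<Rightarrow> real"
  shows "open S \<Longrightarrow> smooth_on S f \<Longrightarrow> smooth_on S g \<Longrightarrow> smooth_on S (\<lambda>x. f x * g x)"
  using Ck_on_scaleR[of S _ f g] by (simp add: smooth_on_def)

lemma smooth_on_divide_const [smooth_intros]:
  fixes f :: "_ \<Rightarrow> real"
  shows "open S \<Longrightarrow> smooth_on S f \<Longrightarrow> smooth_on S (\<lambda>x. f x / c)"
  using smooth_on_bounded_linear_compose[OF _ bounded_linear_divide] .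

lemma smooth_on_sin [smooth_intros]:
    "open S \<Longrightarrow> smooth_on S f \<Longrightarrow> smooth_on S (\<lambda>x. sin (f x :: real))"
  and smooth_on_cos [smooth_intros]:
    "open S \<Longrightarrow> smooth_on S f \<Longrightarrow> smooth_on S (\<lambda>x. cos (f x :: real))"
  by (rule smooth_on_compose[of S UNIV f]; simp add: smooth_on_def Ck_on_sin_cos)+

lemma smooth_on_imp_continuous_on: "smooth_on S f \<Longrightarrow> continuous_on S f"
  unfolding smooth_on_def using Ck_on.simps(1) by blast

section \<open>Manifolds covered by a Euclidean space\<close>

text \<open>Around a preimage in \<open>W\<close> there is a rectangle \<open>U \<times> V\<close>
  inside \<open>W\<close>, and its image is the open rectangle \<open>f\<close> U \<times> g
  \<open>V\<close>.\<close>

lemma open_map_prod_top: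
  assumes "open_map X X' f" "open_map Y Y' g"
  shows "open_map (prod_topology X Y) (prod_topology X' Y') (map_prod f g)"
  unfolding open_map_def
proof (intro allI impI)
  fix W assume W: "openin (prod_topology X Y) W"
  show "openin (prod_topology X' Y') (map_prod f g ` W)"
    unfolding openin_prod_topology_alt
  proof (intro allI impI)
    fix a b assume "(a, b) \<in> map_prod f g ` W"
    then obtain x y where xy: "(x, y) \<in> W" "a = f x" "b = g y" by auto
    then obtain U V where UV: "openin X U" "openin Y V" "x \<in> U" "y \<in> V" "U \<times> V \<subseteq> W"
      using W unfolding openin_prod_topology_alt by meson
    have "f ` U \<times> g ` V \<subseteq> map_prod f g ` W"
      using UV(5) by (force simp: image_iff)
    then show "\<exists>U V. openin X' U \<and> openin Y' V \<and> a \<in> U \<and> b \<in> V \<and> U \<times> V \<subseteq> map_prod f g ` W"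
      using assms UV xy unfolding open_map_def by blast
  qed
qed

text \<open>The images of a countable basis of the source form a countable basis: they are open
  because \<open>p\<close> is open, and they are fine enough because \<open>p\<close> is continuous
  and onto.\<close>

lemma second_countable_space_open_map_image:
  fixes p :: "'e::second_countable_topology \<Rightarrow> 'p"
  assumes "continuous_map euclidean X p" "open_map euclidean X p" "range p = topspace X"
  shows "second_countable_space X"
proof -
  obtain B :: "'e set set" where B: "countable B" "topological_basis B"
    using ex_countable_basis by blast
  show ?thesis
    unfolding second_countable_space_def
  proof (intro exI conjI ballI allI impI)
    show "countable ((`) p ` B)" using B(1) by simp
    show "openin X C" if C: "C \<in> (`) p ` B" for C
      proof -
      obtain D where "D \<in> B" "C = p ` D" using C by blast
      then show ?thesis
        using assms(2) topological_basis_open[OF B(2)] by (simp add: open_map_def)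
    qed
    fix U x assume U: "openin X U \<and> x \<in> U"
    then obtain a where a: "x = p a" using assms(3) openin_subset by blast
    have "open {b. p b \<in> U}"
      using openin_continuous_map_preimage[OF assms(1), of U] U by simp
    then obtain C where "C \<in> B" "a \<in> C" "C \<subseteq> {b. p b \<in> U}"
      using topological_basisE[OF B(2)] U a by (metis mem_Collect_eq)
    with a show "\<exists>C\<in>(`) p ` B. x \<in> C \<and> C \<subseteq> U" by blast
  qed
qed

text \<open>The assumption \<open>deck\<close> provides the deck transformations of \<open>p\<close>. As they are smooth, smoothness
  of a map can be read off from any lift, whichever sheet a chart of the target belongs to.\<close>

locale euclidean_covering =
  fixes M :: "('p, 'e::euclidean_space) mfd" and p :: "'e \<Rightarrow> 'p"
  assumes Hausdorff: "Hausdorff_space (mtop M)"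
    and range_p: "range p = topspace (mtop M)"
    and continuous_p: "continuous_map euclidean (mtop M) p"
    and open_p: "open_map euclidean (mtop M) p"
    and charts: "(U, \<phi>) \<in> charts M \<Longrightarrow> \<exists>W. open W \<and> U = p ` W \<and> (\<forall>w\<in>W. \<phi> (p w) = w)"
    and charts_cover: "\<exists>(U, \<phi>)\<in>charts M. p a \<in> U"
    and deck: "p a = p b \<Longrightarrow> \<exists>\<delta>. smooth_on UNIV \<delta> \<and> \<delta> a = b \<and> (\<forall>x. p (\<delta> x) = p x)"
begin

text \<open>On the sheet \<open>W\<close> the map \<open>p\<close> is continuous, open and
  injective, with left inverse \<open>\<phi>\<close>. It is therefore a homeomorphism onto
  \<open>U\<close>, and its inverse agrees with \<open>\<phi>\<close> on \<open>U\<close>.\<close>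

lemma is_chart:
  assumes "(U, \<phi>) \<in> charts M"
  shows "is_chart (mtop M) U \<phi>"
proof -
  obtain W where W: "open W" "U = p ` W" "\<And>w. w \<in> W \<Longrightarrow> \<phi> (p w) = w"
    using charts[OF assms] by blast
  then have img: "\<phi> ` U = W" by force
  have U: "openin (mtop M) U" using open_p W(1,2) by (simp add: open_map_def)
  have top: "topspace (subtopology (mtop M) U) = U"
    using U by (meson openin_subset topspace_subtopology_subset)
  have "homeomorphic_map (top_of_set W) (subtopology (mtop M) U) p"
  proof (rule bijective_open_imp_homeomorphic_map)
    show "continuous_map (top_of_set W) (subtopology (mtop M) U) p"
      using continuous_p W(2) by (auto simp: continuous_map_in_subtopology intro: continuous_map_from_subtopology)
    show "open_map (top_of_set W) (subtopology (mtop M) U) p"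
      unfolding open_map_def
    proof (intro allI impI)
      fix T assume "openin (top_of_set W) T"
      then have "openin (mtop M) (p ` T)" "p ` T \<subseteq> U"
        using W(1,2) open_p by (auto simp: open_map_def openin_open_eq)
      then show "openin (subtopology (mtop M) U) (p ` T)"
        using U by (simp add: openin_open_subtopology)
    qed
    show "inj_on p (topspace (top_of_set W))" using W(3) by (intro inj_on_inverseI[of _ \<phi>]) simp
  qed (use top W(2) in simp)
  then obtain \<psi> where \<psi>: "homeomorphic_maps (top_of_set W) (subtopology (mtop M) U) p \<psi>"
    by (auto simp: homeomorphic_map_maps)
  have "homeomorphic_maps (top_of_set W) (subtopology (mtop M) U) p \<phi>"
  proof (rule homeomorphic_maps_eq[OF \<psi>])
    fix y assume "y \<in> topspace (subtopology (mtop M) U)"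
    then obtain w where w: "w \<in> W" "y = p w" using W(2) top by blast
    have "\<psi> (p w) = w" using \<psi> w(1) by (simp add: homeomorphic_maps_def)
    then show "\<psi> y = \<phi> y" using W(3) w by simp
  qed simp
  then have "homeomorphic_map (subtopology (mtop M) U) (top_of_set W) \<phi>"
    by (simp add: homeomorphic_maps_map)
  with U W(1) show ?thesis by (simp add: is_chart_def img)
qed

lemma quotient_map_p: "quotient_map euclidean (mtop M) p"
  using continuous_open_imp_quotient_map[OF continuous_p open_p] range_p by simp

text \<open>In coordinates \<open>f\<close> is locally the lift \<open>F\<close> followed by a deck
  transformation of the target. With identities for \<open>f\<close> and \<open>F\<close> this also
  yields the transition maps of the atlas.\<close>

lemma smooth_transition:
  fixes N :: "('q, 'f::euclidean_space) mfd"
  assumes "euclidean_covering N q"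
    and F: "smooth_on UNIV F" "\<And>a. f (p a) = q (F a)"
    and UV: "(U, \<phi>) \<in> charts M" "(V, \<psi>) \<in> charts N"
  shows "smooth_on (\<phi> ` (U \<inter> f -` V)) (\<psi> \<circ> f \<circ> inv_into U \<phi>)"
proof -
  interpret N: euclidean_covering N q by fact
  obtain W where W: "open W" "U = p ` W" "\<And>w. w \<in> W \<Longrightarrow> \<phi> (p w) = w"
    using charts[OF UV(1)] by blast
  obtain W' where W': "open W'" "V = q ` W'" "\<And>w. w \<in> W' \<Longrightarrow> \<psi> (q w) = w"
    using N.charts[OF UV(2)] by blast
  have inv: "inv_into U \<phi> w = p w" if "w \<in> W" for w
    using W that by (intro inv_into_f_eq inj_on_inverseI[of _ p]) auto
  show ?thesis
    unfolding smooth_on_def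
  proof (intro allI Ck_on_local)
    fix k w assume "w \<in> \<phi> ` (U \<inter> f -` V)"
    then have w: "w \<in> W" "q (F w) \<in> V" using W F(2) by auto
    then obtain w' where w': "w' \<in> W'" "q (F w) = q w'" using W'(2) by blast
    \<comment> \<open>\<open>F w\<close> may lie outside the sheet \<open>W'\<close> on which
      \<open>\<psi>\<close> inverts \<open>q\<close>; \<open>\<delta>\<close> moves it there within
      its fibre.\<close>
    then obtain \<delta> where \<delta>: "smooth_on UNIV \<delta>" "\<delta> (F w) = w'" "\<And>x. q (\<delta> x) = q x"
      using N.deck by meson
    let ?g = "\<lambda>x. \<delta> (F x)"
    have g: "smooth_on UNIV ?g" by (rule smooth_on_compose[OF _ _ _ F(1) \<delta>(1)]) simp_all
    have "open (?g -` W')"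
      using smooth_on_imp_continuous_on[OF g] W'(1) by (simp add: open_vimage)
    \<comment> \<open>Here \<open>f (p y) = q (F y) = q (?g y)\<close>, and \<open>\<psi>\<close>
      inverts \<open>q\<close> at \<open>?g y \<in> W'\<close>.\<close>
    moreover have "(\<psi> \<circ> f \<circ> inv_into U \<phi>) y = ?g y" if "y \<in> W \<inter> ?g -` W'" for y
      using that inv F(2) W'(3)[of "?g y"] \<delta>(3) by simp
    moreover have "Ck_on k (W \<inter> ?g -` W') ?g"
      using g by (auto simp: smooth_on_def intro: Ck_on_subset)
    ultimately show "\<exists>T g. open T \<and> w \<in> T \<and> Ck_on k T g \<and> (\<forall>y\<in>T. (\<psi> \<circ> f \<circ> inv_into U \<phi>) y = g y)"
      using w w' \<delta>(2) W(1) by (intro exI[of _ "W \<inter> ?g -` W'"] exI[of _ ?g]) auto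
  qed
qed

text \<open>Continuity descends from \<open>q \<circ> F\<close> because \<open>p\<close> is a
  quotient map; smoothness in charts is \<open>smooth_transition\<close>.\<close>

lemma smooth_map_of_lift:
  assumes "euclidean_covering N q" "smooth_on UNIV F" "\<And>a. f (p a) = q (F a)"
  shows "smooth_map M N f"
proof -
  interpret N: euclidean_covering N q by fact
  have "continuous_map euclidean euclidean F"
    using smooth_on_imp_continuous_on[OF assms(2)] by simp
  then have "continuous_map euclidean (mtop N) (q \<circ> F)"
    using N.continuous_p by (rule continuous_map_compose)
  moreover have "f \<circ> p = q \<circ> F" using assms(3) by auto
  ultimately have "continuous_map (mtop M) (mtop N) f"
    by (metis continuous_compose_quotient_map quotient_map_p)
  then show ?thesis
    using smooth_transition[OF assms] by (auto simp: smooth_map_def)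
qed

lemma smooth_manifold: "smooth_manifold M"
proof -
  have "U \<subseteq> topspace (mtop M)" if "(U, \<phi>) \<in> charts M" for U \<phi>
    using charts[OF that] range_p by blast
  moreover have "\<exists>(U, \<phi>)\<in>charts M. x \<in> U" if "x \<in> topspace (mtop M)" for x
    using that range_p charts_cover by (metis rangeE)
  ultimately have "(\<Union>(U, \<phi>)\<in>charts M. U) = topspace (mtop M)" by fast
  moreover have "smooth_on (\<phi> ` (U \<inter> V)) (\<psi> \<circ> inv_into U \<phi>)"
    if "(U, \<phi>) \<in> charts M" "(V, \<psi>) \<in> charts M" for U \<phi> V \<psi>
    using smooth_transition[OF euclidean_covering_axioms smooth_on_id, of "\<lambda>x. x", OF _ _ that]
    by (simp add: o_def)
  ultimately show ?thesis
    using second_countable_space_open_map_image[OF continuous_p open_p range_p] Hausdorff is_chart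
    by (auto simp: smooth_manifold_def)
qed

end

text \<open>One direction of \<open>fibres\<close> lets \<open>F\<close> descend to the quotients,
  the other lets its inverse \<open>G\<close> descend. The descended maps are mutually inverse
  because \<open>F\<close> and \<open>G\<close> are.\<close>

lemma diffeomorphic_of_lift:
  assumes "euclidean_covering M p" "euclidean_covering N q"
    and F: "smooth_on UNIV F" and G: "smooth_on UNIV G"
    and GF: "\<And>a. G (F a) = a" and FG: "\<And>b. F (G b) = b"
    and fibres: "\<And>a b. p a = p b \<longleftrightarrow> q (F a) = q (F b)"
  shows "diffeomorphic M N"
proof -
  interpret M: euclidean_covering M p by fact
  interpret N: euclidean_covering N q by fact
  \<comment> \<open>\<open>inv_into\<close> picks an arbitrary point of the fibre; the equations for
    \<open>f (p a)\<close> and \<open>g (q b)\<close> below show that the choice does not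
    matter.\<close>
  define f where "f x = q (F (inv_into UNIV p x))" for x
  define g where "g y = p (G (inv_into UNIV q y))" for y
  have f: "f (p a) = q (F a)" for a
    unfolding f_def using fibres by (metis f_inv_into_f rangeI)
  have g: "g (q b) = p (G b)" for b
    unfolding g_def using fibres FG by (metis f_inv_into_f rangeI)
  have "g (f x) = x" if "x \<in> topspace (mtop M)" for x
    using that M.range_p f g GF by (metis rangeE)
  moreover have "f (g y) = y" if "y \<in> topspace (mtop N)" for y
    using that N.range_p f g FG by (metis rangeE)
  ultimately show ?thesis
    using M.smooth_manifold N.smooth_manifold
      M.smooth_map_of_lift[OF assms(2) F f] N.smooth_map_of_lift[OF assms(1) G g]
    unfolding diffeomorphic_def by blast
qed

text \<open>All data are formed componentwise: sheets are products of sheets, and a deck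
  transformation is a pair acting on the two coordinates.\<close>

lemma euclidean_covering_prod:
  assumes "euclidean_covering M p" "euclidean_covering N q"
  shows "euclidean_covering (prod_mfd M N) (map_prod p q)"
proof -
  interpret M: euclidean_covering M p by fact
  interpret N: euclidean_covering N q by fact
  show ?thesis
  proof
    show "Hausdorff_space (mtop (prod_mfd M N))"
      by (simp add: prod_mfd_def Hausdorff_space_prod_topology M.Hausdorff N.Hausdorff)
    show "range (map_prod p q) = topspace (mtop (prod_mfd M N))"
    proof -
      have "range (map_prod p q) = range p \<times> range q" by force
      then show ?thesis by (simp add: prod_mfd_def M.range_p N.range_p)
    qed
    show "continuous_map euclidean (mtop (prod_mfd M N)) (map_prod p q)"
      using M.continuous_p N.continuous_p
      by (simp add: prod_mfd_def map_prod_def continuous_map_prod_top flip: prod_topology_euclidean)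
    show "open_map euclidean (mtop (prod_mfd M N)) (map_prod p q)"
      using open_map_prod_top[OF M.open_p N.open_p] by (simp add: prod_mfd_def)
  next
    fix U \<phi> assume "(U, \<phi>) \<in> charts (prod_mfd M N)"
    then obtain U1 \<phi>1 U2 \<phi>2 where eq: "U = U1 \<times> U2" "\<phi> = map_prod \<phi>1 \<phi>2"
      and "(U1, \<phi>1) \<in> charts M" "(U2, \<phi>2) \<in> charts N"
      by (auto simp: prod_mfd_def)
    then obtain W1 W2 where "open W1" "U1 = p ` W1" "\<forall>w\<in>W1. \<phi>1 (p w) = w"
      "open W2" "U2 = q ` W2" "\<forall>w\<in>W2. \<phi>2 (q w) = w"
      using M.charts N.charts by meson
    then show "\<exists>W. open W \<and> U = map_prod p q ` W \<and> (\<forall>w\<in>W. \<phi> (map_prod p q w) = w)"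
      by (intro exI[of _ "W1 \<times> W2"]) (auto simp: eq open_Times)
  next
    fix a :: "'b \<times> 'd"
    obtain a1 a2 where a: "a = (a1, a2)" by fastforce
    obtain U1 \<phi>1 where 1: "(U1, \<phi>1) \<in> charts M" "p a1 \<in> U1"
      using M.charts_cover[of a1] by auto
    obtain U2 \<phi>2 where 2: "(U2, \<phi>2) \<in> charts N" "q a2 \<in> U2"
      using N.charts_cover[of a2] by auto
    have "(U1 \<times> U2, map_prod \<phi>1 \<phi>2) \<in> charts (prod_mfd M N)"
      unfolding prod_mfd_def using 1(1) 2(1) by auto
    then show "\<exists>(U, \<phi>)\<in>charts (prod_mfd M N). map_prod p q a \<in> U"
      by (rule bexI[rotated]) (use 1(2) 2(2) a in simp)
  next
    fix a b :: "'b \<times> 'd" assume "map_prod p q a = map_prod p q b"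
    then have "p (fst a) = p (fst b)" "q (snd a) = q (snd b)"
      by (auto simp: map_prod_def split_def)
    then obtain \<delta> \<epsilon> where \<delta>: "smooth_on UNIV \<delta>" "\<delta> (fst a) = fst b" "\<And>x. p (\<delta> x) = p x"
      and \<epsilon>: "smooth_on UNIV \<epsilon>" "\<epsilon> (snd a) = snd b" "\<And>x. q (\<epsilon> x) = q x"
      using M.deck N.deck by meson
    have "smooth_on UNIV (\<lambda>x. \<delta> (fst x))" "smooth_on UNIV (\<lambda>x. \<epsilon> (snd x))"
      by (rule smooth_on_compose[OF _ _ _ _ \<delta>(1)] smooth_on_compose[OF _ _ _ _ \<epsilon>(1)];
          simp add: smooth_intros)+
    then have "smooth_on UNIV (\<lambda>x. (\<delta> (fst x), \<epsilon> (snd x)))" by (intro smooth_intros) simp_all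
    with \<delta> \<epsilon> show "\<exists>\<delta>. smooth_on UNIV \<delta> \<and> \<delta> a = b \<and> (\<forall>x. map_prod p q (\<delta> x) = map_prod p q x)"
      by (intro exI[of _ "\<lambda>x. (\<delta> (fst x), \<epsilon> (snd x))"]) (auto simp: map_prod_def split_def)
  qed
qed

section \<open>The circle covered by the real line\<close>

lemma cis_eq_cis_iff: "cis s = cis t \<longleftrightarrow> (\<exists>n::int. t = s + 2 * pi * of_int n)"
  using sin_cos_eq_iff[of t s] by (auto simp: complex_eq_iff)

text \<open>\<open>cis ` W\<close> is the trace on the circle of the image of the horizontal strips over \<open>W\<close> under the
  covering map \<open>exp\<close> of the punctured plane.\<close>

lemma open_map_cis: "open_map euclidean (top_of_set (sphere 0 1)) cis"
  unfolding open_map_def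
proof (intro allI impI)
  fix W :: "real set" assume "openin euclidean W"
  then have W: "open W" by simp
  let ?S = "{z. Im z \<in> W}"
  have "open (Im -` W)" using W by (intro open_vimage) (auto intro: continuous_intros)
  then have "open ?S" by (simp add: vimage_def)
  then have "openin (top_of_set (- {0})) (exp ` ?S)"
    by (intro covering_space_open_map[OF covering_space_exp_punctured_plane]) simp
  then have "open (exp ` ?S)"
    by (simp add: openin_open_eq open_Compl)
  moreover have "cis ` W = sphere 0 1 \<inter> exp ` ?S"
  proof
    show "cis ` W \<subseteq> sphere 0 1 \<inter> exp ` ?S"
    proof
      fix w assume "w \<in> cis ` W"
      then obtain t where "t \<in> W" "w = cis t" by blast
      then show "w \<in> sphere 0 1 \<inter> exp ` ?S"
        by (auto simp: cis_conv_exp intro!: image_eqI[of _ _ "\<i> * of_real t"])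
    qed
    show "sphere 0 1 \<inter> exp ` ?S \<subseteq> cis ` W"
    proof
      fix w assume "w \<in> sphere 0 1 \<inter> exp ` ?S"
      then obtain z where z: "Im z \<in> W" "w = exp z" "cmod (exp z) = 1" by auto
      \<comment> \<open>The modulus of \<open>exp z\<close> is \<open>exp (Re z)\<close>.\<close>
      then have "Re z = 0" by simp
      with z show "w \<in> cis ` W" by (simp add: exp_eq_polar)
    qed
  qed
  ultimately show "openin (top_of_set (sphere 0 1)) (cis ` W)"
    by (simp add: openin_open_Int)
qed

lemma euclidean_covering_circle: "euclidean_covering circle_mfd cis"
proof
  show "Hausdorff_space (mtop circle_mfd)"
    by (simp add: circle_mfd_def Hausdorff_space_subtopology)
  have "w \<in> range cis" if "cmod w = 1" for w
    using that rcis_cmod_Arg[of w] by (metis rangeI rcis_def mult_1 of_real_1)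
  then show "range cis = topspace (mtop circle_mfd)"
    by (auto simp: circle_mfd_def)
  show "continuous_map euclidean (mtop circle_mfd) cis"
    by (auto simp: circle_mfd_def continuous_map_in_subtopology intro!: continuous_intros)
  show "open_map euclidean (mtop circle_mfd) cis"
    by (simp add: circle_mfd_def open_map_cis)
  show "\<exists>W. open W \<and> U = cis ` W \<and> (\<forall>w\<in>W. \<phi> (cis w) = w)" if UV: "(U, \<phi>) \<in> charts circle_mfd" for U \<phi>
  proof -
    obtain a where a: "U = cis ` {a<..<a + 2 * pi}" "\<phi> = inv_into {a<..<a + 2 * pi} cis"
      using UV by (auto simp: circle_mfd_def)
    have "inj_on cis {a<..<a + 2 * pi}"
    proof (rule inj_onI)
      fix s t assume st: "s \<in> {a<..<a + 2 * pi}" "t \<in> {a<..<a + 2 * pi}" "cis s = cis t"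
      then obtain n :: int where n: "t = s + 2 * pi * of_int n" by (auto simp: cis_eq_cis_iff)
      \<comment> \<open>Two points of an open interval of length \<open>2 * pi\<close> differ by
        less than one period, which forces the integer \<open>n\<close> to vanish.\<close>
      have "\<bar>t - s\<bar> < 2 * pi" using st by auto
      then have "2 * pi * \<bar>real_of_int n\<bar> < 2 * pi * 1" by (simp add: n abs_mult)
      then have "\<bar>real_of_int n\<bar> < 1" by (subst (asm) mult_less_cancel_left_pos) auto
      then have "n = 0" by linarith
      with n show "s = t" by simp
    qed
    then show ?thesis using a by (intro exI[of _ "{a<..<a + 2 * pi}"]) auto
  qed
  show "\<exists>(U, \<phi>)\<in>charts circle_mfd. cis a \<in> U" for a
  proof (rule bexI)
    \<comment> \<open>Starting the interval at \<open>a - pi\<close> makes \<open>a\<close> its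
      midpoint.\<close>
    show "(cis ` {a - pi<..<a - pi + 2 * pi}, inv_into {a - pi<..<a - pi + 2 * pi} cis) \<in> charts circle_mfd"
      unfolding circle_mfd_def mfd.select_convs by blast
  qed simp
  show "\<exists>\<delta>. smooth_on UNIV \<delta> \<and> \<delta> s = t \<and> (\<forall>x. cis (\<delta> x) = cis x)" if "cis s = cis t" for s t
  proof -
    obtain n :: int where n: "t = s + 2 * pi * of_int n" using \<open>cis s = cis t\<close> cis_eq_cis_iff by blast
    have "cis (x + 2 * pi * of_int n) = cis x" for x
      using cis_eq_cis_iff[of x "x + 2 * pi * of_int n"] by auto
    then show ?thesis
      using n by (intro exI[of _ "\<lambda>x. x + 2 * pi * of_int n"]) (simp add: smooth_intros)
  qed
qed

section \<open>Quotients by closed discrete subgroups\<close>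

text \<open>In this form the fibre of the projection through \<open>a\<close> is the orbit of
  \<open>a\<close> under right translations by \<open>H\<close>, the future deck
  transformations.\<close>

lemma (in group) l_coset_eq_iff:
  assumes "subgroup H G" "a \<in> carrier G" "b \<in> carrier G"
  shows "a <# H = b <# H \<longleftrightarrow> (\<exists>h\<in>H. b = a \<otimes> h)"
proof
  assume "a <# H = b <# H"
  then have "b \<in> a <# H" using lcos_self assms by blast
  then show "\<exists>h\<in>H. b = a \<otimes> h" by (auto simp: l_coset_def)
next
  assume "\<exists>h\<in>H. b = a \<otimes> h"
  then have "b \<in> a <# H" by (auto simp: l_coset_def)
  then show "a <# H = b <# H" using l_repr_independence assms by blast
qed

text \<open>In this form the coset relation is the preimage of \<open>H\<close> under a map of
  pairs, so topological properties of \<open>H\<close> pass to the relation.\<close>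

lemma (in group) l_coset_eq_iff_inv_mult:
  assumes "subgroup H G" "a \<in> carrier G" "b \<in> carrier G"
  shows "a <# H = b <# H \<longleftrightarrow> inv a \<otimes> b \<in> H"
proof -
  have "b = a \<otimes> (inv a \<otimes> b)" using assms by (simp add: inv_solve_left m_assoc[symmetric])
  moreover have "inv a \<otimes> (a \<otimes> h) = h" if "h \<in> H" for h
    using that assms subgroup.mem_carrier[OF assms(1)] by (simp add: m_assoc[symmetric])
  ultimately show ?thesis
    unfolding l_coset_eq_iff[OF assms] by metis
qed

text \<open>Right translations by \<open>H\<close> are the deck transformations, and their
  continuity makes the projection open. Closedness of \<open>H\<close> separates cosets, and the
  isolating neighbourhood \<open>V\<close> of the identity provides sheets.\<close>

lemma euclidean_covering_coset:
  fixes G :: "('e::euclidean_space, 'm) monoid_scheme" (structure)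
  assumes "group G" and carrier: "carrier G = UNIV" and H: "subgroup H G"
    and closed: "closed H" and V: "open V" "V \<inter> H = {\<one>}"
    and cont: "continuous_on UNIV (\<lambda>(a, b). inv a \<otimes> b)"
    and smooth: "\<And>h. h \<in> H \<Longrightarrow> smooth_on UNIV (\<lambda>g. g \<otimes> h)"
  shows "euclidean_covering (coset_mfd G H) (\<lambda>g. g <# H)"
proof -
  interpret group G by fact
  let ?p = "\<lambda>g. g <# H" and ?X = "mtop (coset_mfd G H)" and ?d = "\<lambda>(a, b). inv a \<otimes> b"
  have X: "?X = quotient_topology euclidean ?p"
    by (simp add: coset_mfd_def Let_def carrier)
  have eq: "?p a = ?p b \<longleftrightarrow> (\<exists>h\<in>H. b = a \<otimes> h)" for a b
    by (simp add: l_coset_eq_iff H carrier)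
  have eq': "?p a = ?p b \<longleftrightarrow> ?d (a, b) \<in> H" for a b
    by (simp add: l_coset_eq_iff_inv_mult H carrier)
  have range: "range ?p = topspace ?X"
    by (simp add: X topspace_quotient_topology)
  have open_p: "open_map euclidean ?X ?p"
    unfolding open_map_def
  proof (intro allI impI)
    fix W :: "'e set" assume "openin euclidean W"
    then have "open ((\<lambda>g. g \<otimes> h) -` W)" if "h \<in> H" for h
      using smooth_on_imp_continuous_on[OF smooth[OF that]] by (simp add: open_vimage)
    \<comment> \<open>The saturation of \<open>W\<close> is a union of preimages of \<open>W\<close>
      under right translations, hence open.\<close>
    moreover have "{x. ?p x \<in> ?p ` W} = (\<Union>h\<in>H. (\<lambda>g. g \<otimes> h) -` W)"
    proof (intro equalityI subsetI)
      fix x assume "x \<in> {x. ?p x \<in> ?p ` W}"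
      then obtain w where "w \<in> W" "?p x = ?p w" by blast
      then show "x \<in> (\<Union>h\<in>H. (\<lambda>g. g \<otimes> h) -` W)" using eq by auto
    next
      fix x assume "x \<in> (\<Union>h\<in>H. (\<lambda>g. g \<otimes> h) -` W)"
      then obtain h where "h \<in> H" "x \<otimes> h \<in> W" by blast
      then have "?p x = ?p (x \<otimes> h)" using eq by blast
      then show "x \<in> {x. ?p x \<in> ?p ` W}" using \<open>x \<otimes> h \<in> W\<close> by blast
    qed
    ultimately show "openin ?X (?p ` W)"
      by (auto simp: X openin_quotient_topology intro!: open_UN)
  qed
  show ?thesis
  proof
    show "range ?p = topspace ?X" by (rule range)
    show "continuous_map euclidean ?X ?p"
      unfolding X by (intro quotient_imp_continuous_map quotient_map_quotient_topology)
    show "open_map euclidean ?X ?p" by (rule open_p)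
    show "Hausdorff_space ?X"
      unfolding Hausdorff_space_def
    proof (intro allI impI, elim conjE)
      fix x y assume xy: "x \<in> topspace ?X" "y \<in> topspace ?X" "x \<noteq> y"
      then obtain a b where ab: "x = ?p a" "y = ?p b" unfolding range[symmetric] by blast
      \<comment> \<open>Lying in different cosets is an open condition on pairs. A box
        \<open>A \<times> B\<close> inside it has disjoint projections.\<close>
      have "open (?d -` (- H))" using cont closed by (simp add: open_vimage open_Compl)
      moreover have "(a, b) \<in> ?d -` (- H)" using xy(3) eq' ab by auto
      ultimately obtain A B where AB: "open A" "open B" "(a, b) \<in> A \<times> B" "A \<times> B \<subseteq> ?d -` (- H)"
        by (rule open_prod_elim)
      have "?p s \<noteq> ?p t" if "s \<in> A" "t \<in> B" for s t
        using that AB(4) eq'[of s t] by blast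
      then have "disjnt (?p ` A) (?p ` B)" by (fastforce simp: disjnt_def)
      moreover have "openin ?X (?p ` A)" "openin ?X (?p ` B)"
        using open_p AB(1,2) by (simp_all add: open_map_def)
      ultimately show "\<exists>U V. openin ?X U \<and> openin ?X V \<and> x \<in> U \<and> y \<in> V \<and> disjnt U V"
        using AB(3) ab by blast
    qed
    show "\<exists>W. open W \<and> U = ?p ` W \<and> (\<forall>w\<in>W. \<phi> (?p w) = w)"
      if "(U, \<phi>) \<in> charts (coset_mfd G H)" for U \<phi>
    proof -
      obtain W where "open W" "inj_on ?p W" "U = ?p ` W" "\<phi> = inv_into W ?p"
        using \<open>(U, \<phi>) \<in> charts (coset_mfd G H)\<close> by (auto simp: coset_mfd_def Let_def)
      then show ?thesis using inv_into_f_f[of ?p W] by (intro exI[of _ W]) simp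
    qed
    show "\<exists>(U, \<phi>)\<in>charts (coset_mfd G H). ?p a \<in> U" for a
    proof -
      \<comment> \<open>Near \<open>(a, a)\<close> the quotient \<open>inv s \<otimes> t\<close>
        stays in \<open>V\<close>. If \<open>s\<close> and \<open>t\<close> are in the same coset it
        lies in \<open>V \<inter> H\<close>, so \<open>s = t\<close> and the projection is injective
        on \<open>A \<inter> B\<close>.\<close>
      have "open (?d -` V)" using cont V(1) by (simp add: open_vimage)
      moreover have "(a, a) \<in> ?d -` V" using V(2) carrier by auto
      ultimately obtain A B where AB: "open A" "open B" "(a, a) \<in> A \<times> B" "A \<times> B \<subseteq> ?d -` V"
        by (rule open_prod_elim)
      have "inj_on ?p (A \<inter> B)"
      proof (rule inj_onI)
        fix s t assume st: "s \<in> A \<inter> B" "t \<in> A \<inter> B" "?p s = ?p t"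
        then have "inv s \<otimes> t \<in> V \<inter> H" using AB(4) eq'[of s t] by auto
        then have "inv s \<otimes> t = \<one>" using V(2) by blast
        then have "inv s = inv t" using carrier by (simp add: inv_equality inv_comm)
        then show "s = t" using carrier by (metis UNIV_I inv_inv)
      qed
      then have "(?p ` (A \<inter> B), inv_into (A \<inter> B) ?p) \<in> charts (coset_mfd G H)"
        using AB(1,2) carrier by (auto simp: coset_mfd_def Let_def)
      then show ?thesis by (rule bexI[rotated]) (use AB(3) in auto)
    qed
    show "\<exists>\<delta>. smooth_on UNIV \<delta> \<and> \<delta> a = b \<and> (\<forall>x. ?p (\<delta> x) = ?p x)" if ab: "?p a = ?p b" for a b
    proof -
      obtain h where h: "h \<in> H" "b = a \<otimes> h" using ab eq by blast
      have "?p (x \<otimes> h) = ?p x" for x using h(1) eq[of x "x \<otimes> h"] by auto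
      with h show ?thesis using smooth by (intro exI[of _ "\<lambda>g. g \<otimes> h"]) auto
    qed
  qed
qed

section \<open>The Heisenberg and oscillator lattices\<close>

lemma inv_Heis: "inv\<^bsub>Heis\<^esub> (x, y, z) = (- x, - y, - z)"
  by (rule group.inv_equality[OF group_Heis]) (auto simp: Heis_def)

text \<open>The plane part of the inverse is \<open>(- x, - y)\<close> rotated by the angle
  \<open>- t\<close>, which undoes the twist of the product.\<close>

lemma inv_Osc:
  "inv\<^bsub>Osc\<^esub> (t, x, y, z) = (- t, - (x * cos t - y * sin t), - (x * sin t + y * cos t), - z)"
  by (rule group.inv_equality[OF group_Osc]) (auto simp: Osc_def Let_def algebra_simps)

text \<open>Written as a product of preimages of the integers, the lattice can be shown closed and
  isolated at the identity factor by factor.\<close>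

lemma Gamma_lattice_eq:
  assumes "k \<ge> 1"
  shows "Gamma_lattice k = \<int> \<times> \<int> \<times> (\<lambda>z. 2 * real k * z) -` \<int>"
proof -
  have "(\<exists>m::int. z = of_int m / (2 * real k)) \<longleftrightarrow> 2 * real k * z \<in> \<int>" for z
    using assms by (auto simp: Ints_def field_simps)
  then show ?thesis by (auto simp: Gamma_lattice_def)
qed

lemma Lambda_lattice_eq: "Lambda_lattice k = (\<lambda>t. t / (2 * pi)) -` \<int> \<times> Gamma_lattice k"
proof -
  have "(\<exists>n::int. t = 2 * pi * of_int n) \<longleftrightarrow> t / (2 * pi) \<in> \<int>" for t
    by (auto simp: Ints_def field_simps)
  then show ?thesis by (auto simp: Lambda_lattice_def)
qed

lemma closed_Gamma_lattice:
  assumes "k \<ge> 1"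
  shows "closed (Gamma_lattice k)"
  unfolding Gamma_lattice_eq[OF assms]
  by (intro closed_Times closed_Ints closed_vimage continuous_intros)

lemma closed_Lambda_lattice:
  assumes "k \<ge> 1"
  shows "closed (Lambda_lattice k)"
  unfolding Lambda_lattice_eq
  by (intro closed_Times closed_Ints closed_vimage closed_Gamma_lattice assms continuous_intros) simp

text \<open>Multiplication by \<open>c\<close> carries the interval to the one between
  \<open>- 1\<close> and \<open>1\<close>, where \<open>0\<close> is the only integer.\<close>

lemma Ints_vimage_isolated:
  fixes c :: real
  assumes "c > 0"
  shows "{- (1 / c)<..<1 / c} \<inter> (\<lambda>x. c * x) -` \<int> = {0}"
proof (intro equalityI subsetI)
  fix x assume "x \<in> {- (1 / c)<..<1 / c} \<inter> (\<lambda>x. c * x) -` \<int>"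
  then have "\<bar>c * x\<bar> < 1" "c * x \<in> \<int>" using assms by (auto simp: abs_less_iff field_simps)
  then have "c * x = 0" using Ints_nonzero_abs_less1 by blast
  with assms show "x \<in> {0}" by simp
qed (use assms in auto)

lemma Gamma_lattice_isolated:
  assumes "k \<ge> 1"
  shows "({- 1<..<1} \<times> {- 1<..<1} \<times> {- (1 / (2 * real k))<..<1 / (2 * real k)}) \<inter> Gamma_lattice k
    = {(0, 0, 0)}"
  using Ints_vimage_isolated[of 1] Ints_vimage_isolated[of "2 * real k"] assms
  by (simp add: Gamma_lattice_eq Times_Int_Times vimage_def)

lemma Lambda_lattice_isolated:
  assumes "k \<ge> 1"
  shows "({- (2 * pi)<..<2 * pi} \<times> {- 1<..<1} \<times> {- 1<..<1} \<times> {- (1 / (2 * real k))<..<1 / (2 * real k)})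
      \<inter> Lambda_lattice k = {(0, 0, 0, 0)}"
  \<comment> \<open>With \<open>c = 1 / (2 * pi)\<close> the half-length \<open>1 / c\<close> is the
    period \<open>2 * pi\<close>.\<close>
  using Ints_vimage_isolated[of "1 / (2 * pi)"] Gamma_lattice_isolated[OF assms]
  by (simp add: Lambda_lattice_eq Times_Int_Times)

section \<open>Coverings of the Heisenberg and oscillator quotients\<close>

lemma euclidean_covering_Heis:
  assumes "k \<ge> 1"
  shows "euclidean_covering (coset_mfd Heis (Gamma_lattice k)) (\<lambda>g. g <#\<^bsub>Heis\<^esub> Gamma_lattice k)"
proof (rule euclidean_covering_coset[OF group_Heis _ subgroup_Gamma[OF assms] closed_Gamma_lattice[OF assms]])
  let ?V = "{- 1<..<1} \<times> {- 1<..<1} \<times> {- (1 / (2 * real k))<..<1 / (2 * real k)} :: (real \<times> real \<times> real) set"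
  show "carrier Heis = UNIV" by (simp add: Heis_def)
  show "open ?V" by (intro open_Times open_greaterThanLessThan)
  show "?V \<inter> Gamma_lattice k = {\<one>\<^bsub>Heis\<^esub>}"
    using Gamma_lattice_isolated[OF assms] by (simp add: Heis_def)
  have eq: "(\<lambda>(a, b). inv\<^bsub>Heis\<^esub> a \<otimes>\<^bsub>Heis\<^esub> b) =
      (\<lambda>((x, y, z), (x', y', z')). (x' - x, y' - y, z' - z + (x' * y - x * y') / 2))"
    by (auto simp: fun_eq_iff inv_Heis) (auto simp: Heis_def algebra_simps)
  show "continuous_on UNIV (\<lambda>(a, b). inv\<^bsub>Heis\<^esub> a \<otimes>\<^bsub>Heis\<^esub> b)"
    unfolding eq unfolding case_prod_unfold by (intro continuous_intros) simp_all
  fix h assume "h \<in> Gamma_lattice k"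
  obtain x' y' z' where h: "h = (x', y', z')" by (cases h)
  have "(\<lambda>g. g \<otimes>\<^bsub>Heis\<^esub> h) =
      (\<lambda>g. (fst g + x', fst (snd g) + y', snd (snd g) + z' + (fst g * y' - x' * fst (snd g)) / 2))"
    by (auto simp: fun_eq_iff h Heis_def)
  then show "smooth_on UNIV (\<lambda>g. g \<otimes>\<^bsub>Heis\<^esub> h)"
    by (simp add: smooth_intros)
qed

lemma euclidean_covering_Osc:
  assumes "k \<ge> 1"
  shows "euclidean_covering (M_mfd k) (\<lambda>g. g <#\<^bsub>Osc\<^esub> Lambda_lattice k)"
  unfolding M_mfd_def
proof (rule euclidean_covering_coset[OF group_Osc _ subgroup_Lambda[OF assms] closed_Lambda_lattice[OF assms]])
  let ?V = "{- (2 * pi)<..<2 * pi} \<times> {- 1<..<1} \<times> {- 1<..<1} \<times> {- (1 / (2 * real k))<..<1 / (2 * real k)}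
    :: (real \<times> real \<times> real \<times> real) set"
  show "carrier Osc = UNIV" by (simp add: Osc_def)
  show "open ?V" by (intro open_Times open_greaterThanLessThan)
  show "?V \<inter> Lambda_lattice k = {\<one>\<^bsub>Osc\<^esub>}"
    using Lambda_lattice_isolated[OF assms] by (simp add: Osc_def)
  \<comment> \<open>\<open>(X, Y)\<close> is the plane part of the inverse of \<open>a\<close>, and
    \<open>(u, v)\<close> is the plane part of \<open>b\<close> rotated by
    \<open>- t\<close>.\<close>
  have eq: "(\<lambda>(a, b). inv\<^bsub>Osc\<^esub> a \<otimes>\<^bsub>Osc\<^esub> b) =
      (\<lambda>((t, x, y, z), (t', x', y', z')).
        let X = - (x * cos t - y * sin t); Y = - (x * sin t + y * cos t);
          u = x' * cos t - y' * sin t; v = x' * sin t + y' * cos t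
        in (t' - t, X + u, Y + v, z' - z + (X * v - u * Y) / 2))"
    by (auto simp: fun_eq_iff inv_Osc) (auto simp: Osc_def Let_def)
  show "continuous_on UNIV (\<lambda>(a, b). inv\<^bsub>Osc\<^esub> a \<otimes>\<^bsub>Osc\<^esub> b)"
    unfolding eq unfolding case_prod_unfold Let_def by (intro continuous_intros) simp_all
  fix h assume "h \<in> Lambda_lattice k"
  obtain t' x' y' z' where h: "h = (t', x', y', z')" by (cases h)
  \<comment> \<open>The plane part of \<open>h\<close> as twisted by \<open>g\<close>; it depends on
    \<open>g\<close> only through its first coordinate.\<close>
  define u v where "u t = x' * cos t + y' * sin t" and "v t = - x' * sin t + y' * cos t" for t
  have [smooth_intros]: "smooth_on UNIV (\<lambda>g. u (fst g))" "smooth_on UNIV (\<lambda>g. v (fst g))"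
    for g :: "real \<times> real \<times> real \<times> real"
    unfolding u_def v_def by (simp_all add: smooth_intros)
  have "(\<lambda>g. g \<otimes>\<^bsub>Osc\<^esub> h) =
      (\<lambda>g. (fst g + t', fst (snd g) + u (fst g), fst (snd (snd g)) + v (fst g),
        snd (snd (snd g)) + z' + (fst (snd g) * v (fst g) - u (fst g) * fst (snd (snd g))) / 2))"
    by (auto simp: fun_eq_iff h Osc_def Let_def u_def v_def)
  then show "smooth_on UNIV (\<lambda>g. g \<otimes>\<^bsub>Osc\<^esub> h)"
    by (simp add: smooth_intros)
qed

section \<open>Untwisting the oscillator group\<close>

text \<open>The action that defines the semidirect product: clockwise rotation of the plane by
  \<open>t\<close>, with the centre of the Heisenberg group fixed.\<close>

fun rot :: "real \<Rightarrow> real \<times> real \<times> real \<Rightarrow> real \<times> real \<times> real" where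
  "rot t (x, y, z) = (x * cos t + y * sin t, - x * sin t + y * cos t, z)"

lemma rot_add: "rot s (rot t h) = rot (s + t) h"
  by (cases h) (simp add: cos_add sin_add algebra_simps)

lemma rot_0: "rot 0 h = h"
  by (cases h) simp

lemma rot_inverse: "rot (- t) (rot t h) = h" "rot t (rot (- t) h) = h"
  by (simp_all add: rot_add rot_0)

lemma rot_periodic: "rot (2 * pi * of_int n) h = h"
  by (cases h) (simp add: sin_int_2pin cos_int_2pin)

text \<open>Rotations preserve the area form \<open>x * y' - x' * y\<close>, which is the only
  nonlinear term of the Heisenberg product.\<close>

lemma rot_heis_mult: "rot t (heis_mult g h) = heis_mult (rot t g) (rot t h)"
proof -
  obtain x y z x' y' z' where gh: "g = (x, y, z)" "h = (x', y', z')" by (cases g; cases h)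
  have "(x * cos t + y * sin t) * (- x' * sin t + y' * cos t)
      - (x' * cos t + y' * sin t) * (- x * sin t + y * cos t)
      = (x * y' - x' * y) * ((sin t)\<^sup>2 + (cos t)\<^sup>2)"
    unfolding power2_eq_square by algebra
  then have area: "(x * cos t + y * sin t) * (- x' * sin t + y' * cos t)
      - (x' * cos t + y' * sin t) * (- x * sin t + y * cos t) = x * y' - x' * y"
    by simp
  show ?thesis
    unfolding gh heis_mult.simps rot.simps area by (simp add: algebra_simps)
qed

text \<open>The semidirect product form, in which cosets can be compared without
  coordinates.\<close>

lemma osc_mult_eq: "osc_mult (s, g) (t, h) = (s + t, heis_mult g (rot s h))"
  by (cases g; cases h) (simp add: Let_def)

text \<open>The parameter \<open>c\<close> treats the untwisting map, \<open>c = - 1\<close>, and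
  its inverse, \<open>c = 1\<close>, together.\<close>

definition shear :: "real \<Rightarrow> real \<times> real \<times> real \<times> real \<Rightarrow> real \<times> real \<times> real \<times> real" where
  "shear c = (\<lambda>(t, h). (t, rot (c * t) h))"

lemma shear_inverse: "shear (- c) (shear c a) = a"
  by (simp add: shear_def case_prod_unfold rot_inverse del: rot.simps)

lemma smooth_shear: "smooth_on UNIV (shear c)"
proof -
  have "shear c = (\<lambda>g. (fst g,
      fst (snd g) * cos (c * fst g) + fst (snd (snd g)) * sin (c * fst g),
      - fst (snd g) * sin (c * fst g) + fst (snd (snd g)) * cos (c * fst g), snd (snd (snd g))))"
    by (auto simp: fun_eq_iff shear_def)
  then show ?thesis by (simp add: smooth_intros del: mult_minus_left)
qed

text \<open>This is the matching of fibres that lets \<open>shear (- 1)\<close> descend: it turns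
  the twisted right action of the lattice into the product action.\<close>

lemma Osc_coset_eq_iff:
  assumes "k \<ge> 1"
  shows "a <#\<^bsub>Osc\<^esub> Lambda_lattice k = b <#\<^bsub>Osc\<^esub> Lambda_lattice k \<longleftrightarrow>
    map_prod cis (\<lambda>g. g <#\<^bsub>Heis\<^esub> Gamma_lattice k) (shear (- 1) a) =
    map_prod cis (\<lambda>g. g <#\<^bsub>Heis\<^esub> Gamma_lattice k) (shear (- 1) b)"
proof -
  obtain s g t h where ab: "a = (s, g)" "b = (t, h)" by (cases a; cases b)
  \<comment> \<open>Points of one coset have first coordinates that differ by a period, so both may
    be untwisted by the same rotation.\<close>
  have "rot (- s - 2 * pi * of_int n) h = rot (- s) h" for n
    using rot_add[of "- s - 2 * pi * of_int n" "2 * pi * of_int n" h] rot_periodic by simp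
  then have rot: "rot (- t) h = rot (- s) h" if "t = s + 2 * pi * of_int n" for n
    using that by (simp add: algebra_simps)
  have "a <#\<^bsub>Osc\<^esub> Lambda_lattice k = b <#\<^bsub>Osc\<^esub> Lambda_lattice k \<longleftrightarrow>
      (\<exists>l\<in>Lambda_lattice k. b = osc_mult a l)"
    using group.l_coset_eq_iff[OF group_Osc subgroup_Lambda[OF assms], of a b] by (simp add: Osc_def)
  also have "\<dots> \<longleftrightarrow> (\<exists>n. t = s + 2 * pi * of_int n \<and> (\<exists>\<gamma>\<in>Gamma_lattice k. h = heis_mult g (rot s \<gamma>)))"
    by (auto simp: ab Lambda_lattice_def osc_mult_eq)
  also have "\<dots> \<longleftrightarrow> (\<exists>n. t = s + 2 * pi * of_int n \<and>
      (\<exists>\<gamma>\<in>Gamma_lattice k. rot (- t) h = heis_mult (rot (- s) g) \<gamma>))"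
  proof -
    \<comment> \<open>The automorphism \<open>rot (- s)\<close> is applied to both sides and cancels
      the twist of \<open>\<gamma>\<close>.\<close>
    have "h = heis_mult g (rot s \<gamma>) \<longleftrightarrow> rot (- s) h = heis_mult (rot (- s) g) \<gamma>" for \<gamma>
      by (metis rot_heis_mult rot_inverse)
    with rot show ?thesis by metis
  qed
  also have "\<dots> \<longleftrightarrow> cis s = cis t \<and>
      rot (- s) g <#\<^bsub>Heis\<^esub> Gamma_lattice k = rot (- t) h <#\<^bsub>Heis\<^esub> Gamma_lattice k"
    using group.l_coset_eq_iff[OF group_Heis subgroup_Gamma[OF assms], of "rot (- s) g" "rot (- t) h"]
    by (simp add: cis_eq_cis_iff Heis_def)
  finally show ?thesis by (simp add: ab shear_def)
qed

theorem mainTheorem3: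
  fixes k :: nat
  assumes "k \<ge> 1"
  shows "diffeomorphic (M_mfd k) (Kodaira_Thurston k)"
  unfolding Kodaira_Thurston_def
proof (rule diffeomorphic_of_lift[OF euclidean_covering_Osc[OF assms]
      euclidean_covering_prod[OF euclidean_covering_circle euclidean_covering_Heis[OF assms]]
      smooth_shear smooth_shear _ _ Osc_coset_eq_iff[OF assms]])
  show "shear 1 (shear (- 1) a) = a" "shear (- 1) (shear 1 a) = a" for a
    using shear_inverse[of "- 1" a] shear_inverse[of 1 a] by simp_all
qed

end
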